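(* Let $V$ be a finite set, let $\mathcal{M}=(V,\mathcal{F})$ be a matroid all of whose bases have cardinality $N$, and let $f:2^V\to\mathbb{R}$ be an increasing set function with submodularity ratio $\gamma$ and curvature $\alpha$. Let $S^*$ be an optimal solution of $$\min_{S\subseteq V} f(S)\quad\text{s.t.}\quad S\in\mathcal{F},\ |S|=N,$$ and let $S^{\mathsf r}$ be any output of the reverse greedy algorithm applied to this problem. Assume $f(V)\neq f(S^* )$. Then $$\frac{f(V)-f(S^{\mathsf r})}{f(V)-f(S^* )}\ge\frac{1-\alpha}{1+(1-\gamma)(1-\alpha)}.$$
   Context: Notation: $j$ and $\{j\}$ are identified for singletons; $\rho_j(S)=f(S\cup j)-f(S)$ for $S\subseteq V$, $j\in V$; $\delta_j(S)=f(S)-f(S\setminus j)$ for $j\in S\subseteq V$. The function $f$ is not assumed normalized. $f$ is increasing if $f(S)\le f(R)$ for all $S\subseteq R\subseteq V$. The submodularity ratio of an increasing $f$ is the largest $\gamma\in\mathbb{R}_+$ such that $\gamma\rho_j(R)\le\rho_j(S)$ for all $S\subseteq R\subseteq V$ and all $j\in V\setminus R$ (one has $\gamma\in[0,1]$). The curvature of an increasing $f$ is the smallest $\alpha\in\mathbb{R}_+$ such that $\rho_j(R)\ge(1-\alpha)\rho_j(S)$ for all $S\subseteq R\subseteq V$ and all $j\in V\setminus R$ (one has $\alpha\in[0,1]$). A matroid $(V,\mathcal{F})$ is given by its collection $\mathcal{F}$ of independent sets; bases are the independent sets of maximum cardinality. Reverse greedy algorithm: start with $X^0=V$ and with no element of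 $V$ marked as considered. For $t=1,\dots,|V|-N$: repeatedly choose $j\in\arg\max\delta_j(X^{t-1})$ over all not yet considered elements $j\in V$ (ties broken arbitrarily) and mark $j$ as considered (permanently); if $X^{t-1}\setminus j$ does not contain a base of $\mathcal{M}$, keep $j$ in the set and choose again; otherwise set $r_t=j$, $X^t=X^{t-1}\setminus j$ and proceed to the next $t$. The output is $S^{\mathsf r}=X^{|V|-N}$. *)

theory Defs
  imports Complex_Main
begin

definition gain :: "('a set \<Rightarrow> real) \<Rightarrow> 'a \<Rightarrow> 'a set \<Rightarrow> real" where
  "gain f j S = f (insert j S) - f S"

definition loss :: "('a set \<Rightarrow> real) \<Rightarrow> 'a \<Rightarrow> 'a set \<Rightarrow> real" where
  "loss f j S = f S - f (S - {j})"

text \<open>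
  For \<open>f\<close> increasing on the subsets of a finite set \<open>V\<close>, the curvature is always attained as a
  least element. The submodularity ratio is attained as a greatest element unless all gains vanish,
  i.e. unless \<open>f\<close> is constant on the subsets of \<open>V\<close>; in that case no greatest element exists and
  the value is unspecified.
\<close>

definition submodularity_ratio :: "'a set \<Rightarrow> ('a set \<Rightarrow> real) \<Rightarrow> real" where
  "submodularity_ratio V f =
    (GREATEST \<gamma>. 0 \<le> \<gamma> \<and>
      (\<forall>S R. S \<subseteq> R \<and> R \<subseteq> V \<longrightarrow> (\<forall>j\<in>V - R. \<gamma> * gain f j R \<le> gain f j S)))"

definition curvature :: "'a set \<Rightarrow> ('a set \<Rightarrow> real) \<Rightarrow> real" where
  "curvature V f =
    (LEAST \<alpha>. 0 \<le> \<alpha> \<and>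
      (\<forall>S R. S \<subseteq> R \<and> R \<subseteq> V \<longrightarrow> (\<forall>j\<in>V - R. gain f j R \<ge> (1 - \<alpha>) * gain f j S)))"

definition matroid :: "'a set \<Rightarrow> 'a set set \<Rightarrow> bool" where
  "matroid V F \<longleftrightarrow>
    finite V \<and> F \<subseteq> Pow V \<and> {} \<in> F \<and>
    (\<forall>A B. A \<subseteq> B \<and> B \<in> F \<longrightarrow> A \<in> F) \<and>
    (\<forall>A\<in>F. \<forall>B\<in>F. card A < card B \<longrightarrow> (\<exists>x\<in>B - A. insert x A \<in> F))"

definition matroid_base :: "'a set set \<Rightarrow> 'a set \<Rightarrow> bool" where
  "matroid_base F B \<longleftrightarrow> B \<in> F \<and> (\<forall>A\<in>F. card A \<le> card B)"

text \<open>
  \<open>rev_greedy_state V F f N t X C\<close>: some run reaches a situation where \<open>t\<close> elements have been removed,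
  \<open>X\<close> is the current set and \<open>C\<close> is the set of elements marked as considered. Ties are broken
  arbitrarily because every maximiser may be chosen.
\<close>

inductive rev_greedy_state ::
    "'a set \<Rightarrow> 'a set set \<Rightarrow> ('a set \<Rightarrow> real) \<Rightarrow> nat \<Rightarrow> nat \<Rightarrow> 'a set \<Rightarrow> 'a set \<Rightarrow> bool"
  for V F f N where
  start: "rev_greedy_state V F f N 0 V {}"
| keep: "\<lbrakk>rev_greedy_state V F f N t X C; t < card V - N;
     is_arg_max (\<lambda>i. loss f i X) (\<lambda>i. i \<in> V - C) j;
     \<not> (\<exists>B. matroid_base F B \<and> B \<subseteq> X - {j})\<rbrakk>
   \<Longrightarrow> rev_greedy_state V F f N t X (insert j C)"
| remove: "\<lbrakk>rev_greedy_state V F f N t X C; t < card V - N;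
     is_arg_max (\<lambda>i. loss f i X) (\<lambda>i. i \<in> V - C) j;
     \<exists>B. matroid_base F B \<and> B \<subseteq> X - {j}\<rbrakk>
   \<Longrightarrow> rev_greedy_state V F f N (Suc t) (X - {j}) (insert j C)"

definition rev_greedy_output ::
    "'a set \<Rightarrow> 'a set set \<Rightarrow> ('a set \<Rightarrow> real) \<Rightarrow> nat \<Rightarrow> 'a set \<Rightarrow> bool" where
  "rev_greedy_output V F f N S \<longleftrightarrow> (\<exists>C. rev_greedy_state V F f N (card V - N) S C)"

end

theory Submission
  imports Defs
begin

text \<open>
  Removing elements from \<open>V\<close> so as to lower \<open>f\<close> is forward greedy maximisation of
  \<open>T \<mapsto> f V - f (V - T)\<close> over the bases of the dual matroid. Under this duality \<open>1 - \<alpha>\<close> plays the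
  role of a submodularity ratio and \<open>1 - \<gamma>\<close> that of a curvature, so an argument of
  Conforti--Cornuejols type applies.

  Let \<open>O\<close> be any base and \<open>R\<close> the output, let \<open>r\<^sub>s\<close> be the elements removed by the algorithm, and
  let \<open>A\<close> be the sum of the losses \<open>f X\<^sup>s\<^sup>-\<^sup>1 - f X\<^sup>s\<close> over those steps with \<open>r\<^sub>s \<in> O\<close>. Whenever such an
  \<open>r\<^sub>s\<close> is removed, base exchange replaces it in the current modification of \<open>O\<close> by some
  \<open>o\<^sub>s \<in> R - O\<close>. The element \<open>o\<^sub>s\<close> was itself a candidate for removal at step \<open>s\<close>, so its loss is at
  most that of \<open>r\<^sub>s\<close>. In the end the \<open>o\<^sub>s\<close> exhaust \<open>R - O\<close>. Thus \<open>A\<close> bounds, up to curvature, what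
  is lost by shrinking \<open>R\<close> to \<open>R \<inter> O\<close>, whereas the submodularity ratio bounds from below what is
  lost by shrinking \<open>O\<close> to \<open>R \<inter> O\<close>:
  \<open>(1 - \<alpha>) (f R - f (R \<inter> O)) \<le> A\<close> and \<open>f O - f (R \<inter> O) \<ge> \<gamma> A\<close>.
  Subtracting and using \<open>A \<le> f V - f R\<close> gives
  \<open>(1 - \<alpha>) (f V - f O) \<le> (1 + (1 - \<gamma>) (1 - \<alpha>)) (f V - f R)\<close>, which is the claim.
  The lemma \<open>rev_greedy_exchange\<close> builds \<open>A\<close> and the set of the \<open>o\<^sub>s\<close> by induction along the run.
\<close>

section \<open>Gains, curvature and submodularity ratio\<close>

lemma gain_nonneg:
  assumes "mono_on (Pow V) f" "S \<subseteq> V" "j \<in> V"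
  shows "0 \<le> gain f j S"
  using assms by (auto simp: gain_def intro!: mono_onD[of "Pow V" f])

lemma loss_eq_gain: "j \<in> X \<Longrightarrow> loss f j X = gain f j (X - {j})"
  by (simp add: loss_def gain_def insert_absorb)

lemma exists_pos_gain:
  assumes "finite V" "S \<subseteq> V" "mono_on (Pow V) f" "f V \<noteq> f S"
  shows "\<exists>R j. R \<subseteq> V \<and> j \<in> V - R \<and> gain f j R > 0"
proof (rule ccontr)
  assume no_pos: "\<not> ?thesis"
  have zero: "gain f j R = 0" if "R \<subseteq> V" "j \<in> V - R" for R j
  proof (rule antisym)
    show "gain f j R \<le> 0" using that no_pos not_less by blast
    show "0 \<le> gain f j R" using that by (auto intro: gain_nonneg[OF assms(3)])
  qed
  have "f (S \<union> T) = f S" if "finite T" "T \<subseteq> V - S" for T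
    using that
  proof (induction T rule: finite_induct)
    case (insert x T)
    then have "gain f x (S \<union> T) = 0" by (intro zero) (use assms(2) in auto)
    with insert show ?case by (simp add: gain_def)
  qed simp
  from this[of "V - S"] assms show False by (simp add: Un_absorb1)
qed

text \<open>
  The defining inequality of the curvature either is vacuous (for a zero gain) or reads \<open>\<alpha> \<ge> c\<close> for a
  constant \<open>c\<close>, so it survives passing to the infimum of all admissible \<open>\<alpha>\<close>. The value \<open>1\<close> is
  admissible because gains are nonnegative.
\<close>

lemma curvature_properties:
  assumes mono: "mono_on (Pow V) f"
  shows "0 \<le> curvature V f" "curvature V f \<le> 1"
    and "\<And>S R j. S \<subseteq> R \<Longrightarrow> R \<subseteq> V \<Longrightarrow> j \<in> V - R \<Longrightarrow>
      (1 - curvature V f) * gain f j S \<le> gain f j R"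
proof -
  define P where "P \<alpha> \<longleftrightarrow> 0 \<le> \<alpha> \<and>
      (\<forall>S R. S \<subseteq> R \<and> R \<subseteq> V \<longrightarrow> (\<forall>j\<in>V - R. gain f j R \<ge> (1 - \<alpha>) * gain f j S))" for \<alpha>
  have P1: "P 1" unfolding P_def using gain_nonneg[OF mono] by auto
  have bdd: "bdd_below (Collect P)" by (rule bdd_belowI[of _ 0]) (auto simp: P_def)
  define a where "a = Inf (Collect P)"
  have a_le: "a \<le> y" if "P y" for y
    unfolding a_def using that bdd by (intro cInf_lower) auto
  have a_ge: "c \<le> a" if "\<And>y. P y \<Longrightarrow> c \<le> y" for c
    unfolding a_def using that P1 by (intro cInf_greatest) auto
  have "P a" unfolding P_def
  proof (intro conjI allI impI ballI)
    show "0 \<le> a" by (rule a_ge) (auto simp: P_def)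
    fix S R j assume SR: "S \<subseteq> R \<and> R \<subseteq> V" and j: "j \<in> V - R"
    then have nn: "0 \<le> gain f j S" "0 \<le> gain f j R" by (auto intro!: gain_nonneg[OF mono])
    show "(1 - a) * gain f j S \<le> gain f j R"
    proof (cases "gain f j S = 0")
      case False
      then have pos: "gain f j S > 0" using nn by simp
      have "1 - gain f j R / gain f j S \<le> a"
      proof (rule a_ge)
        fix y assume "P y"
        then have "(1 - y) * gain f j S \<le> gain f j R" using SR j by (auto simp: P_def)
        then show "1 - gain f j R / gain f j S \<le> y" using pos by (simp add: field_simps)
      qed
      then show ?thesis using pos by (simp add: field_simps)
    qed (use nn in simp)
  qed
  then have "curvature V f = a"
    unfolding curvature_def P_def[symmetric] by (intro Least_equality a_le)
  with \<open>P a\<close> a_le[OF P1]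
  show "0 \<le> curvature V f" "curvature V f \<le> 1"
    "\<And>S R j. S \<subseteq> R \<Longrightarrow> R \<subseteq> V \<Longrightarrow> j \<in> V - R \<Longrightarrow>
      (1 - curvature V f) * gain f j S \<le> gain f j R"
    unfolding P_def by blast+
qed

text \<open>
  A positive gain, compared with itself (\<open>S = R\<close>), bounds every admissible \<open>\<gamma>\<close> by \<open>1\<close>. This is
  what makes the supremum of the admissible values finite, and hence the greatest one exist.
\<close>

lemma submodularity_ratio_properties:
  assumes mono: "mono_on (Pow V) f" and pos: "R0 \<subseteq> V" "j0 \<in> V - R0" "gain f j0 R0 > 0"
  shows "submodularity_ratio V f \<le> 1"
    and "\<And>S R j. S \<subseteq> R \<Longrightarrow> R \<subseteq> V \<Longrightarrow> j \<in> V - R \<Longrightarrow>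
      submodularity_ratio V f * gain f j R \<le> gain f j S"
proof -
  define P where "P \<gamma> \<longleftrightarrow> 0 \<le> \<gamma> \<and>
      (\<forall>S R. S \<subseteq> R \<and> R \<subseteq> V \<longrightarrow> (\<forall>j\<in>V - R. \<gamma> * gain f j R \<le> gain f j S))" for \<gamma>
  have P0: "P 0" unfolding P_def using gain_nonneg[OF mono] by auto
  have P_le1: "y \<le> 1" if "P y" for y
  proof -
    have "y * gain f j0 R0 \<le> gain f j0 R0" using that pos unfolding P_def by blast
    then show ?thesis using pos(3) by simp
  qed
  have bdd: "bdd_above (Collect P)" by (rule bdd_aboveI[of _ 1]) (auto simp: P_le1)
  define g where "g = Sup (Collect P)"
  have g_ge: "y \<le> g" if "P y" for y
    unfolding g_def using that bdd by (intro cSup_upper) auto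
  have g_le: "g \<le> c" if "\<And>y. P y \<Longrightarrow> y \<le> c" for c
    unfolding g_def using that P0 by (intro cSup_least) auto
  have "P g" unfolding P_def
  proof (intro conjI allI impI ballI)
    show "0 \<le> g" by (rule g_ge[OF P0])
    fix S R j assume SR: "S \<subseteq> R \<and> R \<subseteq> V" and j: "j \<in> V - R"
    then have nn: "0 \<le> gain f j S" "0 \<le> gain f j R" by (auto intro!: gain_nonneg[OF mono])
    show "g * gain f j R \<le> gain f j S"
    proof (cases "gain f j R = 0")
      case False
      then have pos: "gain f j R > 0" using nn by simp
      have "g \<le> gain f j S / gain f j R"
      proof (rule g_le)
        fix y assume "P y"
        then have "y * gain f j R \<le> gain f j S" using SR j by (auto simp: P_def)
        then show "y \<le> gain f j S / gain f j R" using pos by (simp add: field_simps)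
      qed
      then show ?thesis using pos by (simp add: field_simps)
    qed (use nn in simp)
  qed
  then have "submodularity_ratio V f = g"
    unfolding submodularity_ratio_def P_def[symmetric] by (intro Greatest_equality g_ge)
  with \<open>P g\<close> P_le1
  show "submodularity_ratio V f \<le> 1"
    "\<And>S R j. S \<subseteq> R \<Longrightarrow> R \<subseteq> V \<Longrightarrow> j \<in> V - R \<Longrightarrow>
      submodularity_ratio V f * gain f j R \<le> gain f j S"
    unfolding P_def by blast+
qed

section \<open>Matroid bases\<close>

lemma matroid_base_exists:
  assumes "matroid V F"
  obtains B where "matroid_base F B"
proof -
  have "finite F" "{} \<in> F"
    using assms by (auto simp: matroid_def intro: finite_subset)
  then have "Max (card ` F) \<in> card ` F" by (intro Max_in) auto
  then obtain B where "B \<in> F" "Max (card ` F) = card B" by auto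
  with \<open>finite F\<close> have "matroid_base F B"
    unfolding matroid_base_def by (metis Max_ge finite_imageI imageI)
  then show thesis by (rule that)
qed

lemma matroid_base_subset_finite:
  "matroid V F \<Longrightarrow> matroid_base F B \<Longrightarrow> B \<subseteq> V \<and> finite B"
  unfolding matroid_def matroid_base_def by (meson Pow_iff finite_subset subsetD)

lemma matroid_base_card_eq:
  "matroid_base F A \<Longrightarrow> matroid_base F B \<Longrightarrow> card A = card B"
  by (auto simp: matroid_base_def intro: antisym)

lemma matroid_baseI_card:
  "matroid_base F A \<Longrightarrow> B \<in> F \<Longrightarrow> card B = card A \<Longrightarrow> matroid_base F B"
  by (simp add: matroid_base_def)

lemma matroid_base_exchange:
  assumes M: "matroid V F" and A: "matroid_base F A" and B: "matroid_base F B"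
    and x: "x \<in> A" "x \<notin> B"
  obtains y where "y \<in> B - A" "matroid_base F (insert y (A - {x}))"
proof -
  have fin: "finite A" using matroid_base_subset_finite[OF M A] by simp
  have "A - {x} \<in> F" using A M unfolding matroid_def matroid_base_def by blast
  moreover have "card (A - {x}) < card B"
    using fin x(1) matroid_base_card_eq[OF A B] by (metis card_Diff1_less)
  moreover have "B \<in> F" using B by (simp add: matroid_base_def)
  ultimately obtain y where y: "y \<in> B - (A - {x})" "insert y (A - {x}) \<in> F"
    using M unfolding matroid_def by meson
  with x have yA: "y \<in> B - A" by auto
  have "card (insert y (A - {x})) = card A"
    using fin x(1) yA card.remove[of A x] by simp
  from that[OF yA matroid_baseI_card[OF A y(2) this]] show thesis .
qed

section \<open>Runs of the reverse greedy algorithm\<close>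

text \<open>
  Whether \<open>X - {i}\<close> contains a base is monotone in \<open>X\<close>, so an element once rejected
  stays infeasible. Hence every element whose removal is feasible is still unconsidered and
  competes in the next maximisation.
\<close>

lemma rev_greedy_state_invariant:
  assumes "rev_greedy_state V F f N t X C" "matroid V F"
  shows "X \<subseteq> V \<and> V - X \<subseteq> C \<and> card X + t = card V \<and> (\<exists>B. matroid_base F B \<and> B \<subseteq> X) \<and>
    (\<forall>i \<in> C \<inter> X. \<not> (\<exists>B. matroid_base F B \<and> B \<subseteq> X - {i}))"
  using assms
proof (induction rule: rev_greedy_state.induct)
  case start
  obtain B where "matroid_base F B" by (rule matroid_base_exists[OF start])
  with matroid_base_subset_finite[OF start this] show ?case by auto
next
  case (keep t X C j)
  then show ?case by auto
next
  case (remove t X C j)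
  then have IH: "X \<subseteq> V" "V - X \<subseteq> C" "card X + t = card V"
    "\<forall>i \<in> C \<inter> X. \<not> (\<exists>B. matroid_base F B \<and> B \<subseteq> X - {i})" by auto
  from remove have "j \<in> V - C" by (simp add: is_arg_max_def)
  with IH have jX: "j \<in> X" by auto
  have "finite X" using IH(1) remove.prems by (auto simp: matroid_def intro: finite_subset)
  with jX have "card (X - {j}) + Suc t = card X + t" using card.remove[of X j] by simp
  moreover have "\<not> (\<exists>B. matroid_base F B \<and> B \<subseteq> X - {j} - {i})"
    if "i \<in> insert j C \<inter> (X - {j})" for i
    using that IH(4) by blast
  ultimately show ?case using IH(1-3) remove.hyps by auto
qed

text \<open>
  The base \<open>R\<close> stands for the final output, which at an intermediate stage is only known to lie
  in \<open>X\<close>; quantifying over all such \<open>R\<close> lets the induction run forward. The set \<open>Q\<close> collects the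
  elements of \<open>R\<close> exchanged so far for removed elements of \<open>O\<close>, and \<open>A\<close> the losses of these
  removals. Real numbers \<open>c\<close> and \<open>g\<close> stand for \<open>1 - \<alpha>\<close> and \<open>\<gamma>\<close>.
\<close>

lemma rev_greedy_exchange:
  assumes "rev_greedy_state V F f N t X C" and M: "matroid V F" and mono: "mono_on (Pow V) f"
    and curv: "\<And>S R j. S \<subseteq> R \<Longrightarrow> R \<subseteq> V \<Longrightarrow> j \<in> V - R \<Longrightarrow> c * gain f j S \<le> gain f j R"
    and ratio: "\<And>S R j. S \<subseteq> R \<Longrightarrow> R \<subseteq> V \<Longrightarrow> j \<in> V - R \<Longrightarrow> g * gain f j R \<le> gain f j S"
    and O: "matroid_base F Ob" and "matroid_base F R" "R \<subseteq> X"
  shows "\<exists>Q A. Q \<subseteq> R - Ob \<and> matroid_base F (Ob \<inter> X \<union> Q) \<and> A \<le> f V - f X \<and>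
    g * A \<le> f Ob - f (Ob \<inter> X) \<and> c * (f R - f (R - Q)) \<le> A"
  using assms(1,7,8)
proof (induction rule: rev_greedy_state.induct)
  case start
  have "Ob \<inter> V = Ob" using matroid_base_subset_finite[OF M O] by auto
  then show ?case using O by (intro exI[of _ "{}"] exI[of _ 0]) simp
next
  case (keep t X C j)
  then show ?case by blast
next
  case (remove t X C j)
  note inv = rev_greedy_state_invariant[OF remove.hyps(1) M]
  have j: "j \<in> V - C" and j_max: "\<And>i. i \<in> V - C \<Longrightarrow> loss f i X \<le> loss f j X"
    using remove.hyps(3) by (auto simp: is_arg_max_linorder)
  with inv have jX: "j \<in> X" and XV: "X \<subseteq> V" by auto
  from remove.prems have R: "matroid_base F R" "R \<subseteq> X" "j \<notin> R" by auto
  from remove.IH[OF R(1,2)] obtain Q A where QA: "Q \<subseteq> R - Ob" "matroid_base F (Ob \<inter> X \<union> Q)"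
    "A \<le> f V - f X" "g * A \<le> f Ob - f (Ob \<inter> X)" "c * (f R - f (R - Q)) \<le> A"
    by auto
  have loss_nn: "0 \<le> loss f j X"
    using gain_nonneg[OF mono, of "X - {j}" j] XV jX by (auto simp: loss_eq_gain)
  show ?case
  proof (cases "j \<in> Ob")
    case False
    then have "Ob \<inter> (X - {j}) = Ob \<inter> X" by auto
    then show ?thesis using QA loss_nn
      by (intro exI[of _ Q] exI[of _ A]) (auto simp: loss_def)
  next
    case True
    let ?B = "Ob \<inter> X \<union> Q"
    obtain q where q: "q \<in> R - ?B" "matroid_base F (insert q (?B - {j}))"
      using matroid_base_exchange[OF M QA(2) R(1), of j] True jX R(3) by auto
    have qX: "q \<in> X" "q \<in> V" "q \<notin> Ob" "q \<notin> Q" using q(1) R(2) XV by auto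
    \<comment> \<open>The modified base \<open>?B\<close> witnesses that removing \<open>q\<close> instead of \<open>j\<close> was feasible.\<close>
    have "?B \<subseteq> X - {q}" using QA(1) R(2) q(1) by auto
    with inv QA(2) qX have "q \<in> V - C" by blast
    then have loss_le: "loss f q X \<le> loss f j X" by (rule j_max)
    have "c * gain f q (R - insert q Q) \<le> gain f q (X - {q})"
      using R(2) XV qX by (intro curv) auto
    also have "\<dots> \<le> loss f j X" using loss_le qX by (simp add: loss_eq_gain)
    finally have curv_q: "c * gain f q (R - insert q Q) \<le> loss f j X" .
    have "insert q (R - insert q Q) = R - Q" using q(1) by auto
    then have c_bound: "c * (f R - f (R - insert q Q)) \<le> A + loss f j X"
      using curv_q QA(5) by (simp add: gain_def algebra_simps)
    have "g * gain f j (X - {j}) \<le> gain f j (Ob \<inter> X - {j})"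
      using XV jX by (intro ratio) auto
    moreover have "insert j (Ob \<inter> X - {j}) = Ob \<inter> X" "Ob \<inter> (X - {j}) = Ob \<inter> X - {j}"
      using True jX by auto
    ultimately have g_bound: "g * (A + loss f j X) \<le> f Ob - f (Ob \<inter> (X - {j}))"
      using QA(4) jX by (simp add: loss_eq_gain gain_def algebra_simps)
    have "insert q (?B - {j}) = Ob \<inter> (X - {j}) \<union> insert q Q"
      using QA(1) R(3) by auto
    with q have base: "matroid_base F (Ob \<inter> (X - {j}) \<union> insert q Q)" by simp
    show ?thesis
      using QA(1,3) q(1) qX(3) c_bound g_bound base
      by (intro exI[of _ "insert q Q"] exI[of _ "A + loss f j X"]) (auto simp: loss_def)
  qed
qed

section \<open>The approximation guarantee\<close>

theorem theorem2:
  fixes V :: "'a set" and F :: "'a set set" and N :: nat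
    and f :: "'a set \<Rightarrow> real" and Sopt Srev :: "'a set"
  assumes "finite V"
    and "matroid V F"
    and "\<forall>B. matroid_base F B \<longrightarrow> card B = N"
    and "mono_on (Pow V) f"
    and "is_arg_min f (\<lambda>S. S \<subseteq> V \<and> S \<in> F \<and> card S = N) Sopt"
    and "rev_greedy_output V F f N Srev"
    and "f V \<noteq> f Sopt"
  shows "(f V - f Srev) / (f V - f Sopt)
    \<ge> (1 - curvature V f) / (1 + (1 - submodularity_ratio V f) * (1 - curvature V f))"
proof -
  note M = assms(2) and mono = assms(4)
  define c where "c = 1 - curvature V f"
  define g where "g = submodularity_ratio V f"
  have Sopt: "Sopt \<subseteq> V" "Sopt \<in> F" "card Sopt = N"
    using assms(5) by (auto simp: is_arg_min_def)
  obtain B0 where B0: "matroid_base F B0" by (rule matroid_base_exists[OF M])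
  have O: "matroid_base F Sopt"
    using Sopt assms(3) B0 by (auto intro: matroid_baseI_card[OF B0])
  have c01: "0 \<le> c" "c \<le> 1" and curv: "\<And>S R j. S \<subseteq> R \<Longrightarrow> R \<subseteq> V \<Longrightarrow> j \<in> V - R \<Longrightarrow>
      c * gain f j S \<le> gain f j R"
    using curvature_properties[OF mono] by (auto simp: c_def)
  obtain R0 j0 where "R0 \<subseteq> V" "j0 \<in> V - R0" "gain f j0 R0 > 0"
    using exists_pos_gain[OF assms(1) Sopt(1) mono assms(7)] by blast
  note ratio_props = submodularity_ratio_properties[OF mono this, folded g_def]
  obtain C where run: "rev_greedy_state V F f N (card V - N) Srev C"
    using assms(6) by (auto simp: rev_greedy_output_def)
  note inv = rev_greedy_state_invariant[OF run M]
  have SrevV: "Srev \<subseteq> V" using inv by simp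
  have "N \<le> card V" using Sopt assms(1) card_mono by blast
  \<comment> \<open>The output contains a base and has the size of one.\<close>
  with inv have "card Srev = N" by linarith
  moreover obtain B where "matroid_base F B" "B \<subseteq> Srev" using inv by blast
  ultimately have R: "matroid_base F Srev"
    using assms(3) card_subset_eq[OF finite_subset[OF SrevV assms(1)], of B] by auto
  obtain Q A where Q: "Q \<subseteq> Srev - Sopt" "matroid_base F (Sopt \<inter> Srev \<union> Q)"
    and A: "A \<le> f V - f Srev" "g * A \<le> f Sopt - f (Sopt \<inter> Srev)"
      "c * (f Srev - f (Srev - Q)) \<le> A"
    using rev_greedy_exchange[OF run M mono curv ratio_props(2) O R order_refl] by blast
  \<comment> \<open>Bases are equicardinal, so the exchanges have exhausted the whole difference.\<close>
  have "Sopt \<inter> Srev \<union> Q = Srev"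
    using Q card_subset_eq[of Srev "Sopt \<inter> Srev \<union> Q"] matroid_base_card_eq[OF Q(2) R]
      finite_subset[OF SrevV assms(1)] by blast
  with Q(1) have "Srev - Q = Sopt \<inter> Srev" by auto
  with A(3) have A3: "c * (f Srev - f (Sopt \<inter> Srev)) \<le> A" by simp
  have "c * g \<le> 1" using c01 ratio_props(1) mult_left_mono[of g 1 c] by linarith
  then have "(1 - c * g) * A \<le> (1 - c * g) * (f V - f Srev)"
    using A(1) by (intro mult_left_mono) auto
  moreover have "c * (g * A) \<le> c * (f Sopt - f (Sopt \<inter> Srev))"
    using A(2) c01(1) by (rule mult_left_mono)
  ultimately have main: "c * (f V - f Sopt) \<le> (f V - f Srev) * (1 + (1 - g) * c)"
    using A3 by (simp add: algebra_simps)
  have "f Sopt \<le> f V" using mono Sopt(1) by (auto intro: mono_onD[of "Pow V" f])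
  with assms(7) have pos1: "0 < f V - f Sopt" by simp
  have pos2: "0 < 1 + (1 - g) * c"
    using ratio_props(1) c01(1) by (intro add_pos_nonneg) auto
  have "c / (1 + (1 - g) * c) \<le> (f V - f Srev) / (f V - f Sopt)"
    using main pos1 pos2 by (simp add: pos_divide_le_eq pos_le_divide_eq)
  then show ?thesis by (simp add: c_def g_def)
qed

end
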